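(* Let $W$ be a nearly symmetric word in the two letters $A,B$. Then for every $n\ge 1$ and every pair of $n\times n$ positive definite matrices substituted for $A$ and $B$, all eigenvalues of the resulting matrix $W(A,B)$ are positive real numbers.
   Context: A word is a finite sequence of letters from the alphabet $\{A,B\}$ (repetition allowed). It is symmetric if it reads the same right to left as left to right; the empty word counts as symmetric. A word is nearly symmetric if it is either symmetric or the juxtaposition (concatenation) of two symmetric words. $W(A,B)$ denotes the matrix product obtained by substituting matrices for the letters $A,B$ (the empty word gives the identity matrix). Positive definite means real symmetric positive definite or complex Hermitian positive definite (both cases are allowed). *)

theory Defs
  imports Jordan_Normal_Form.Schur_Decomposition
begin

datatype letter = LetterA | LetterB

type_synonym word = "letter list"

definition symmetric_word :: "word \<Rightarrow> bool" where
  "symmetric_word w \<longleftrightarrow> rev w = w"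

definition nearly_symmetric_word :: "word \<Rightarrow> bool" where
  "nearly_symmetric_word w \<longleftrightarrow>
     symmetric_word w \<or> (\<exists>u v. symmetric_word u \<and> symmetric_word v \<and> w = u @ v)"

text \<open>The dimension \<open>n\<close> is a parameter because the empty word denotes the identity matrix.\<close>

fun word_mat :: "nat \<Rightarrow> 'a::semiring_1 mat \<Rightarrow> 'a mat \<Rightarrow> word \<Rightarrow> 'a mat" where
  "word_mat n A B [] = 1\<^sub>m n"
| "word_mat n A B (LetterA # w) = A * word_mat n A B w"
| "word_mat n A B (LetterB # w) = B * word_mat n A B w"

text \<open>
  One definition covers both kinds of positive definite matrix: over \<^typ>\<open>real\<close> conjugation is
  the identity, so it says real symmetric positive definite; over \<^typ>\<open>complex\<close> it says Hermitian
  positive definite, where \<open>0 < z\<close> is the order of \<open>HOL-Library.Complex_Order\<close>, that is,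
  \<open>z\<close> is real and positive.
\<close>

definition pos_def_mat :: "nat \<Rightarrow> 'a::conjugatable_ordered_field mat \<Rightarrow> bool" where
  "pos_def_mat n A \<longleftrightarrow>
     A \<in> carrier_mat n n \<and> mat_adjoint A = A \<and>
     (\<forall>v\<in>carrier_vec n. v \<noteq> 0\<^sub>v n \<longrightarrow> 0 < (A *\<^sub>v v) \<bullet>c v)"

end

theory Submission
  imports Defs
begin

text \<open>
  Two observations carry the proof.

  First, a symmetric word in positive definite matrices is again positive definite. Peeling the
  equal first and last letters off a symmetric word writes its matrix as \<open>M * U * M\<close>, where
  \<open>M\<close> is one of the given matrices and \<open>U\<close> belongs to a shorter symmetric word. As \<open>M\<close> is
  Hermitian and injective, this is a congruence, and congruences preserve positive definiteness
  (\<open>pos_def_mat_congruence\<close>). The peeling ends at the identity matrix or at a single letter.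

  Second, a product \<open>P * Q\<close> of two positive definite matrices has positive eigenvalues
  (\<open>eigenvalue_mult_pos_def_mat\<close>). Pairing \<open>P Q v = \<mu> v\<close> with the vector \<open>Q v\<close>
  gives \<open>\<langle>P (Q v), Q v\<rangle> = \<mu> \<langle>v, Q v\<rangle> = \<mu> \<langle>Q v, v\<rangle>\<close>, which exhibits \<open>\<mu>\<close> as a quotient of
  two positive numbers.

  A nearly symmetric word is a product of two symmetric words, one of them possibly empty, so these
  settle the complex case. A real positive definite matrix stays positive definite when it is read
  as a complex matrix (\<open>pos_def_mat_complex_of_real\<close>), so the real case is an instance of the complex
  one.
\<close>

section \<open>Adjoints\<close>

lemma mat_adjoint_dim [simp]:
  "dim_row (mat_adjoint A) = dim_col A" "dim_col (mat_adjoint A) = dim_row A"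
  by (simp_all add: mat_adjoint_def)

lemma mat_adjoint_carrier [simp]:
  "A \<in> carrier_mat n m \<Longrightarrow> mat_adjoint A \<in> carrier_mat m n"
  by (intro carrier_matI) auto

lemma mat_adjoint_index [simp]:
  "i < dim_col A \<Longrightarrow> j < dim_row A \<Longrightarrow> mat_adjoint A $$ (i, j) = conjugate (A $$ (j, i))"
  by (simp add: mat_adjoint_def mat_of_rows_index)

lemma mat_adjoint_adjoint [simp]: "mat_adjoint (mat_adjoint A) = A"
  by (rule eq_matI) simp_all

lemma mat_adjoint_one:
  "mat_adjoint (1\<^sub>m n :: 'a::conjugatable_field mat) = 1\<^sub>m n"
proof -
  \<comment> \<open>Conjugation is multiplicative, so it fixes the unit by cancellation.\<close>
  have "conjugate (1 :: 'a) * conjugate 1 = conjugate 1 * 1"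
    by (simp flip: conjugate_dist_mul)
  then have "conjugate (1 :: 'a) = 1"
    by (metis conjugate_zero_iff mult_left_cancel zero_neq_one)
  then show ?thesis
    by (intro eq_matI) auto
qed

lemma mat_adjoint_mult:
  assumes "A \<in> carrier_mat n m" and "B \<in> carrier_mat m k"
  shows "mat_adjoint (A * B) = mat_adjoint B * mat_adjoint A"
  by (rule eq_matI)
    (use assms in \<open>auto simp: scalar_prod_def sum_conjugate conjugate_dist_mul mult.commute
      intro!: sum.cong\<close>)

lemma cscalar_prod_adjoint:
  assumes A: "A \<in> carrier_mat n m" and v: "v \<in> carrier_vec m" and w: "w \<in> carrier_vec n"
  shows "(A *\<^sub>v v) \<bullet>c w = v \<bullet>c (mat_adjoint A *\<^sub>v w)"
proof -
  have "conjugate (mat_adjoint A *\<^sub>v w) = A\<^sup>T *\<^sub>v conjugate w"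
    by (rule eq_vecI)
      (use A w in \<open>auto simp: scalar_prod_def sum_conjugate conjugate_dist_mul intro!: sum.cong\<close>)
  moreover have "(A *\<^sub>v v) \<bullet>c w = v \<bullet> (A\<^sup>T *\<^sub>v conjugate w)"
    using transpose_vec_mult_scalar[of "A\<^sup>T" m n "conjugate w" v] A v w by simp
  ultimately show ?thesis by simp
qed

section \<open>Positive definite matrices\<close>

lemma pos_def_matI:
  assumes "A \<in> carrier_mat n n" and "mat_adjoint A = A"
    and "\<And>v. v \<in> carrier_vec n \<Longrightarrow> v \<noteq> 0\<^sub>v n \<Longrightarrow> 0 < (A *\<^sub>v v) \<bullet>c v"
  shows "pos_def_mat n A"
  using assms unfolding pos_def_mat_def by blast

lemma pos_def_mat_carrier: "pos_def_mat n A \<Longrightarrow> A \<in> carrier_mat n n"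
  by (simp add: pos_def_mat_def)

lemma pos_def_mat_hermitian: "pos_def_mat n A \<Longrightarrow> mat_adjoint A = A"
  by (simp add: pos_def_mat_def)

lemma pos_def_mat_pos:
  "pos_def_mat n A \<Longrightarrow> v \<in> carrier_vec n \<Longrightarrow> v \<noteq> 0\<^sub>v n \<Longrightarrow> 0 < (A *\<^sub>v v) \<bullet>c v"
  by (simp add: pos_def_mat_def)

lemma pos_def_mat_mult_nonzero:
  assumes "pos_def_mat n A" and v: "v \<in> carrier_vec n" "v \<noteq> 0\<^sub>v n"
  shows "A *\<^sub>v v \<noteq> 0\<^sub>v n"
  using pos_def_mat_pos[OF assms] v(1) by auto

lemma pos_def_mat_one: "pos_def_mat n (1\<^sub>m n)"
  by (simp add: pos_def_mat_def mat_adjoint_one)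

text \<open>
  Moving \<open>M\<close> across the inner product turns the quadratic form of \<open>M\<^sup>* P M\<close> at \<open>v\<close> into that of
  \<open>P\<close> at \<open>M v\<close>; injectivity of \<open>M\<close> keeps \<open>M v\<close> nonzero.
\<close>

lemma pos_def_mat_congruence:
  assumes P: "pos_def_mat m P" and M: "M \<in> carrier_mat m n"
    and inj: "\<And>v. v \<in> carrier_vec n \<Longrightarrow> v \<noteq> 0\<^sub>v n \<Longrightarrow> M *\<^sub>v v \<noteq> 0\<^sub>v m"
  shows "pos_def_mat n (mat_adjoint M * (P * M))"
proof -
  note Pc = pos_def_mat_carrier[OF P]
  have "mat_adjoint (mat_adjoint M * (P * M)) = mat_adjoint M * P * M"
    using M Pc pos_def_mat_hermitian[OF P]
    by (simp add: mat_adjoint_mult[of _ n m _ n] mat_adjoint_mult[of _ m m _ n])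
  then have herm: "mat_adjoint (mat_adjoint M * (P * M)) = mat_adjoint M * (P * M)"
    using M Pc by (simp add: assoc_mult_mat[of _ n m _ m _ n])
  have "0 < ((mat_adjoint M * (P * M)) *\<^sub>v v) \<bullet>c v"
    if v: "v \<in> carrier_vec n" "v \<noteq> 0\<^sub>v n" for v
  proof -
    have Mv: "M *\<^sub>v v \<in> carrier_vec m"
      using M v by simp
    have "(mat_adjoint M * (P * M)) *\<^sub>v v = mat_adjoint M *\<^sub>v (P *\<^sub>v (M *\<^sub>v v))"
      using M Pc v by (simp add: assoc_mult_mat_vec[of _ n m _ n] assoc_mult_mat_vec[of _ m m _ n])
    then have "((mat_adjoint M * (P * M)) *\<^sub>v v) \<bullet>c v = (P *\<^sub>v (M *\<^sub>v v)) \<bullet>c (M *\<^sub>v v)"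
      using cscalar_prod_adjoint[of "mat_adjoint M" n m "P *\<^sub>v (M *\<^sub>v v)" v] M Pc v Mv by simp
    then show ?thesis
      using pos_def_mat_pos[OF P Mv] inj[OF v] by simp
  qed
  moreover have "mat_adjoint M * (P * M) \<in> carrier_mat n n"
    using mult_carrier_mat[OF mat_adjoint_carrier[OF M] mult_carrier_mat[OF Pc M]] .
  ultimately show ?thesis
    using herm by (intro pos_def_matI)
qed

text \<open>
  The form of \<open>P\<close> at \<open>Q v\<close> equals \<open>\<mu>\<close> times the form of \<open>Q\<close> at \<open>v\<close>, and both forms are positive.
\<close>

lemma eigenvalue_mult_pos_def_mat:
  fixes P Q :: "complex mat"
  assumes P: "pos_def_mat n P" and Q: "pos_def_mat n Q" and "eigenvalue (P * Q) \<mu>"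
  shows "0 < \<mu>"
proof -
  note Pc = pos_def_mat_carrier[OF P] and Qc = pos_def_mat_carrier[OF Q]
  obtain v where v: "v \<in> carrier_vec n" "v \<noteq> 0\<^sub>v n" and ev: "(P * Q) *\<^sub>v v = \<mu> \<cdot>\<^sub>v v"
    using assms(3) carrier_matD(1)[OF Pc]
    unfolding eigenvalue_def eigenvector_def index_mult_mat by metis
  have u: "Q *\<^sub>v v \<in> carrier_vec n" "Q *\<^sub>v v \<noteq> 0\<^sub>v n"
    using Qc v pos_def_mat_mult_nonzero[OF Q v] by auto
  have "(P *\<^sub>v (Q *\<^sub>v v)) \<bullet>c (Q *\<^sub>v v) = \<mu> * (v \<bullet>c (Q *\<^sub>v v))"
    unfolding assoc_mult_mat_vec[OF Pc Qc v(1), symmetric] ev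
    by (rule smult_scalar_prod_distrib[OF v(1) carrier_vec_conjugate[OF u(1)]])
  also have "v \<bullet>c (Q *\<^sub>v v) = (Q *\<^sub>v v) \<bullet>c v"
    using cscalar_prod_adjoint[OF Qc v(1) v(1)] pos_def_mat_hermitian[OF Q] by simp
  finally have "(P *\<^sub>v (Q *\<^sub>v v)) \<bullet>c (Q *\<^sub>v v) = \<mu> * ((Q *\<^sub>v v) \<bullet>c v)" .
  moreover note pos_def_mat_pos[OF P u] pos_def_mat_pos[OF Q v]
  ultimately show ?thesis
    by (auto simp: less_complex_def zero_less_mult_iff)
qed

text \<open>
  For a real symmetric \<open>A\<close> and \<open>v = x + \<i> y\<close>, the number \<open>\<langle>A v, v\<rangle>\<close> is real because \<open>A\<close> is Hermitian,
  and its real part is \<open>\<langle>A x, x\<rangle> + \<langle>A y, y\<rangle>\<close>, where at least one of \<open>x\<close> and \<open>y\<close> is nonzero.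
\<close>

lemma pos_def_mat_complex_of_real:
  assumes A: "pos_def_mat n (A :: real mat)"
  shows "pos_def_mat n (map_mat complex_of_real A)"
proof -
  note Ac = pos_def_mat_carrier[OF A]
  let ?A = "map_mat complex_of_real A"
  have Ac': "?A \<in> carrier_mat n n"
    using Ac by simp
  have "mat_adjoint ?A = map_mat complex_of_real (mat_adjoint A)"
    by (rule eq_matI) simp_all
  then have herm: "mat_adjoint ?A = ?A"
    using pos_def_mat_hermitian[OF A] by simp
  have "0 < (?A *\<^sub>v v) \<bullet>c v" if v: "v \<in> carrier_vec n" "v \<noteq> 0\<^sub>v n" for v
  proof -
    let ?x = "map_vec Re v" and ?y = "map_vec Im v"
    let ?q = "(?A *\<^sub>v v) \<bullet>c v"
    have xy: "?x \<in> carrier_vec n" "?y \<in> carrier_vec n"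
      using v by auto
    have "cnj ?q = conjugate (?A *\<^sub>v v) \<bullet> v"
      using conjugate_sprod_vec[of "?A *\<^sub>v v" n "conjugate v"] Ac v by simp
    also have "\<dots> = v \<bullet>c (?A *\<^sub>v v)"
      using conjugate_vec_sprod_comm[of v n "?A *\<^sub>v v"] Ac v by simp
    also have "\<dots> = ?q"
      using cscalar_prod_adjoint[OF Ac' v(1) v(1)] herm by simp
    finally have im: "Im ?q = 0"
      by (simp add: complex_eq_iff)
    have "map_vec Re (?A *\<^sub>v v) = A *\<^sub>v ?x" "map_vec Im (?A *\<^sub>v v) = A *\<^sub>v ?y"
      by (rule eq_vecI; use Ac v in \<open>auto simp: scalar_prod_def intro!: sum.cong\<close>)+
    then have entries: "Re ((?A *\<^sub>v v) $ i) = (A *\<^sub>v ?x) $ i"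
        "Im ((?A *\<^sub>v v) $ i) = (A *\<^sub>v ?y) $ i" if "i < n" for i
      using Ac that by (metis carrier_matD(1) dim_mult_mat_vec index_map_mat(2) index_map_vec(1))+
    have "Re ?q = (\<Sum>i<n. Re ((?A *\<^sub>v v) $ i) * Re (v $ i) + Im ((?A *\<^sub>v v) $ i) * Im (v $ i))"
      using v Ac by (simp add: scalar_prod_def[of _ "conjugate v"] atLeast0LessThan
          del: index_mult_mat_vec)
    also have "\<dots> = (A *\<^sub>v ?x) \<bullet>c ?x + (A *\<^sub>v ?y) \<bullet>c ?y"
      using v Ac by (simp add: entries scalar_prod_def[of "A *\<^sub>v _"] atLeast0LessThan sum.distrib
          del: index_mult_mat_vec)
    finally have re: "Re ?q = (A *\<^sub>v ?x) \<bullet>c ?x + (A *\<^sub>v ?y) \<bullet>c ?y" .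
    have "?x \<noteq> 0\<^sub>v n \<or> ?y \<noteq> 0\<^sub>v n"
    proof (rule ccontr)
      assume "\<not> ?thesis"
      then have "Re (v $ i) = 0" "Im (v $ i) = 0" if "i < n" for i
        using that v(1) by (metis carrier_vecD index_map_vec(1) index_zero_vec(1))+
      then have "v = 0\<^sub>v n"
        using v(1) by (intro eq_vecI) (auto simp: complex_eq_iff)
      with v(2) show False by simp
    qed
    moreover have "0 \<le> (A *\<^sub>v w) \<bullet>c w" if "w \<in> carrier_vec n" for w
      using pos_def_mat_pos[OF A that] Ac by (cases "w = 0\<^sub>v n") auto
    ultimately have "0 < Re ?q"
      unfolding re using pos_def_mat_pos[OF A] xy by (metis add_nonneg_pos add_pos_nonneg)
    with im show ?thesis
      by (simp add: less_complex_def)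
  qed
  with Ac' herm show ?thesis
    by (rule pos_def_matI)
qed

section \<open>Words\<close>

lemma word_mat_carrier [simp]:
  "A \<in> carrier_mat n n \<Longrightarrow> B \<in> carrier_mat n n \<Longrightarrow> word_mat n A B w \<in> carrier_mat n n"
  by (induction n A B w rule: word_mat.induct) auto

lemma word_mat_append:
  assumes "A \<in> carrier_mat n n" and "B \<in> carrier_mat n n"
  shows "word_mat n A B (u @ v) = word_mat n A B u * word_mat n A B v"
proof (induction u)
  case Nil
  show ?case using assms by (simp add: left_mult_one_mat[of _ n n])
next
  case (Cons x u)
  then show ?case using assms by (cases x) (simp_all add: assoc_mult_mat[of _ n n _ n _ n])
qed

lemma map_mat_word_mat:
  fixes A B :: "real mat"
  assumes "A \<in> carrier_mat n n" and "B \<in> carrier_mat n n"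
  shows "map_mat complex_of_real (word_mat n A B w) =
    word_mat n (map_mat complex_of_real A) (map_mat complex_of_real B) w"
proof (induction w)
  case Nil
  show ?case by (simp add: of_real_hom.mat_hom_one)
next
  case (Cons x w)
  then show ?case
    using assms by (cases x) (simp_all add: of_real_hom.mat_hom_mult[of _ n n _ n])
qed

lemma symmetric_word_induct [consumes 1, case_names Nil single Cons_snoc]:
  assumes "symmetric_word w"
    and "P []"
    and "\<And>x. P [x]"
    and "\<And>x w. symmetric_word w \<Longrightarrow> P w \<Longrightarrow> P (x # w @ [x])"
  shows "P w"
  using assms(1)
proof (induction w rule: length_induct)
  case (1 w)
  show ?case
  proof (cases w)
    case Nil
    then show ?thesis using assms(2) by simp
  next
    case (Cons x t)
    show ?thesis
    proof (cases t rule: rev_cases)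
      case Nil
      then show ?thesis using Cons assms(3) by simp
    next
      case (snoc u y)
      then have w: "w = x # u @ [y]"
        using Cons by simp
      have "rev (x # u @ [y]) = x # u @ [y]"
        using "1.prems" unfolding symmetric_word_def w .
      then have "y # rev u @ [x] = x # u @ [y]"
        unfolding rev.simps rev_append append.simps .
      then have "y = x" and u: "symmetric_word u"
        unfolding symmetric_word_def list.inject append_eq_append_conv2 by auto
      moreover have "P u"
        using "1.IH" u by (simp add: w)
      ultimately show ?thesis
        using assms(4)[OF u] w by simp
    qed
  qed
qed

text \<open>
  The outer letters of a symmetric word agree, so the two outer factors are the same matrix
  \<open>M = M\<^sup>*\<close>, and each induction step is a congruence by \<open>M\<close>.
\<close>

lemma pos_def_mat_symmetric_word:
  assumes "symmetric_word w" and A: "pos_def_mat n A" and B: "pos_def_mat n B"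
  shows "pos_def_mat n (word_mat n A B w)"
  using assms(1)
proof (induction rule: symmetric_word_induct)
  case Nil
  show ?case by (simp add: pos_def_mat_one)
next
  case (single x)
  show ?case
    using A B by (cases x) (simp_all add: pos_def_mat_carrier right_mult_one_mat[of _ n n])
next
  case (Cons_snoc x w)
  define M where "M = (case x of LetterA \<Rightarrow> A | LetterB \<Rightarrow> B)"
  have M: "pos_def_mat n M"
    using A B by (cases x) (simp_all add: M_def)
  note Mc = pos_def_mat_carrier[OF M]
  have "word_mat n A B (x # w @ [x]) = M * (word_mat n A B w * M)"
    using A B by (cases x)
      (simp_all add: M_def word_mat_append pos_def_mat_carrier right_mult_one_mat[of _ n n])
  also have "\<dots> = mat_adjoint M * (word_mat n A B w * M)"
    using pos_def_mat_hermitian[OF M] by simp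
  finally show ?case
    using pos_def_mat_congruence[OF Cons_snoc.IH Mc] pos_def_mat_mult_nonzero[OF M] by simp
qed

lemma nearly_symmetric_wordE:
  assumes "nearly_symmetric_word w"
  obtains u v where "symmetric_word u" "symmetric_word v" "w = u @ v"
  \<comment> \<open>A symmetric word is its own product with the empty word.\<close>
  using assms by (metis append_Nil2 nearly_symmetric_word_def rev.simps(1) symmetric_word_def)

lemma eigenvalue_nearly_symmetric_word:
  fixes A B :: "complex mat"
  assumes "nearly_symmetric_word w" and A: "pos_def_mat n A" and B: "pos_def_mat n B"
    and "eigenvalue (word_mat n A B w) \<mu>"
  shows "0 < \<mu>"
proof -
  obtain u v where uv: "symmetric_word u" "symmetric_word v" "w = u @ v"
    using assms(1) by (rule nearly_symmetric_wordE)
  have "eigenvalue (word_mat n A B u * word_mat n A B v) \<mu>"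
    using assms(4) A B by (simp add: uv(3) word_mat_append pos_def_mat_carrier)
  with uv(1,2) A B show ?thesis
    by (intro eigenvalue_mult_pos_def_mat[OF pos_def_mat_symmetric_word pos_def_mat_symmetric_word])
qed

theorem theorem1p3:
  fixes W :: word and n :: nat
  assumes "nearly_symmetric_word W" and "n \<ge> 1"
  shows "(\<forall>A B :: real mat. pos_def_mat n A \<longrightarrow> pos_def_mat n B \<longrightarrow>
            (\<forall>\<mu> :: complex. eigenvalue (map_mat complex_of_real (word_mat n A B W)) \<mu> \<longrightarrow>
               \<mu> \<in> \<real> \<and> Re \<mu> > 0)) \<and>
         (\<forall>A B :: complex mat. pos_def_mat n A \<longrightarrow> pos_def_mat n B \<longrightarrow>
            (\<forall>\<mu> :: complex. eigenvalue (word_mat n A B W) \<mu> \<longrightarrow>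
               \<mu> \<in> \<real> \<and> Re \<mu> > 0))"
proof -
  have pos: "\<mu> \<in> \<real> \<and> Re \<mu> > 0"
    if "pos_def_mat n A" "pos_def_mat n B" "eigenvalue (word_mat n A B W) \<mu>"
    for A B :: "complex mat" and \<mu>
    using eigenvalue_nearly_symmetric_word[OF assms(1) that]
    by (simp add: less_complex_def complex_is_Real_iff)
  moreover have "\<mu> \<in> \<real> \<and> Re \<mu> > 0"
    if "pos_def_mat n A" "pos_def_mat n B"
      "eigenvalue (map_mat complex_of_real (word_mat n A B W)) \<mu>"
    for A B :: "real mat" and \<mu>
    using that pos[OF pos_def_mat_complex_of_real pos_def_mat_complex_of_real]
    by (simp add: map_mat_word_mat pos_def_mat_carrier)
  ultimately show ?thesis by blast
qed

end
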